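(* Suppose $1\to N\to G^*\xrightarrow{\phi}G\to1$ is a universal central extension of a perfect multiplicative Lie algebra $G$. Then $N\cong\tilde M(G)$ and $G^*$ is a cover of $G$.
   Context: A multiplicative Lie algebra is a triple $(G,\cdot,\star)$ where $(G,\cdot)$ is a group (not necessarily abelian) and $\star$ is a binary operation on $G$ such that for all $x,y,z\in G$, writing ${}^xy=xyx^{-1}$: (1) $x\star x=1$; (2) $x\star(yz)=(x\star y)\,{}^y(x\star z)$; (3) $(xy)\star z={}^x(y\star z)\,(x\star z)$; (4) $((x\star y)\star{}^yz)((y\star z)\star{}^zx)((z\star x)\star{}^xy)=1$; (5) ${}^z(x\star y)={}^zx\star{}^zy$. An ideal is a normal subgroup $H$ with $x\star y\in H$ for all $x\in G$, $y\in H$. Homomorphisms are group homomorphisms preserving $\star$. For ideals $A,B$ of a multiplicative Lie algebra, at least one of which is the whole algebra, ${}^M[A,B]=(A\star B)[A,B]$, where $A\star B$ (resp. $[A,B]$) is the subgroup generated by all $a\star b$ (resp. $[a,b]=aba^{-1}b^{-1}$), $a\in A$, $b\in B$; it is an ideal. $G$ is perfect if ${}^M[G,G]=G$. $Z(G)$ is the group center, $LZ(G)=\{x\in G: x\star y=1\ \forall y\in G\}$, $\mathcal{Z}(G)=LZ(G)\cap Z(G)$. The Schur multiplier of $G$ is $\tilde M(G)=({}^M[F,F]\cap R)/{}^M[R,F]$ for any free presentation $1\to R\to F\to G\to1$ (short exact sequence of multiplicative Lie algebras with $F$ a free multiplicative Lie algebra on a set); it is independent of the presentation up to isomorphism. A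 central extension $1\to N\to G^*\to G\to1$ is a short exact sequence of multiplicative Lie algebras with $N\subseteq\mathcal{Z}(G^* )$. It is universal if for every central extension $1\to H\to K\xrightarrow{\psi}G\to1$ there is a unique homomorphism $\theta:G^*\to K$ with $\psi\circ\theta=\phi$, where $\phi:G^*\to G$ is the given map. A central extension is a stem extension if $N\subseteq{}^M[G^*,G^*]$, and a stem cover if in addition $N\cong\tilde M(G)$; in that case $G^*$ is called a cover of $G$. *)

theory Defs
  imports "HOL-Algebra.Coset" "HOL-Algebra.Generated_Groups"
begin

text \<open>
  The notions of free multiplicative Lie algebra and of universal central extension
  quantify over all multiplicative Lie algebras. HOL cannot quantify over types inside a
  formula, so these quantifiers range over all multiplicative Lie algebras whose carrier is a
  subset of one arbitrary type \<^typ>\<open>'u\<close>, which plays the role of a universe and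
  which also contains the algebras under consideration. If \<^typ>\<open>'u\<close> is infinite,
  both notions agree with the unrestricted ones: an extension of \<open>G\<close> by an algebra of any size,
  or a map of a basis into an algebra of any size, can be tested on subalgebras generated by at most
  \<open>|UNIV :: 'u set|\<close> elements, and these have isomorphic copies inside \<^typ>\<open>'u\<close>.
\<close>


section \<open>Multiplicative Lie algebras\<close>

record 'a mla = "'a monoid" +
  lie :: "'a \<Rightarrow> 'a \<Rightarrow> 'a" (infixl \<open>\<star>\<index>\<close> 70)

definition conj_by :: "('a, 'm) monoid_scheme \<Rightarrow> 'a \<Rightarrow> 'a \<Rightarrow> 'a" where
  "conj_by G x y = x \<otimes>\<^bsub>G\<^esub> y \<otimes>\<^bsub>G\<^esub> inv\<^bsub>G\<^esub> x"

locale mult_lie_algebra = group G for G :: "('a, 'm) mla_scheme" (structure) +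
  assumes lie_closed: "\<lbrakk>x \<in> carrier G; y \<in> carrier G\<rbrakk> \<Longrightarrow> x \<star> y \<in> carrier G"
    and lie_self: "x \<in> carrier G \<Longrightarrow> x \<star> x = \<one>"
    and lie_mult_right: "\<lbrakk>x \<in> carrier G; y \<in> carrier G; z \<in> carrier G\<rbrakk> \<Longrightarrow>
      x \<star> (y \<otimes> z) = (x \<star> y) \<otimes> conj_by G y (x \<star> z)"
    and lie_mult_left: "\<lbrakk>x \<in> carrier G; y \<in> carrier G; z \<in> carrier G\<rbrakk> \<Longrightarrow>
      (x \<otimes> y) \<star> z = conj_by G x (y \<star> z) \<otimes> (x \<star> z)"
    and lie_jacobi: "\<lbrakk>x \<in> carrier G; y \<in> carrier G; z \<in> carrier G\<rbrakk> \<Longrightarrow>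
      ((x \<star> y) \<star> conj_by G y z) \<otimes> ((y \<star> z) \<star> conj_by G z x) \<otimes> ((z \<star> x) \<star> conj_by G x y) = \<one>"
    and lie_conj: "\<lbrakk>x \<in> carrier G; y \<in> carrier G; z \<in> carrier G\<rbrakk> \<Longrightarrow>
      conj_by G z (x \<star> y) = conj_by G z x \<star> conj_by G z y"

definition mla_hom :: "('a, 'm) mla_scheme \<Rightarrow> ('b, 'n) mla_scheme \<Rightarrow> ('a \<Rightarrow> 'b) set" where
  "mla_hom G H = {h \<in> hom G H.
     \<forall>x\<in>carrier G. \<forall>y\<in>carrier G. h (x \<star>\<^bsub>G\<^esub> y) = h x \<star>\<^bsub>H\<^esub> h y}"

definition mla_isomorphic :: "('a, 'm) mla_scheme \<Rightarrow> ('b, 'n) mla_scheme \<Rightarrow> bool" where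
  "mla_isomorphic G H \<longleftrightarrow> (\<exists>h\<in>mla_hom G H. bij_betw h (carrier G) (carrier H))"

text \<open>As for \<^const>\<open>FactGroup\<close>, the quotient is only meaningful when \<open>H\<close> is an ideal of \<open>G\<close>;
  the union below is then a single coset.\<close>

definition mla_quotient :: "('a, 'm) mla_scheme \<Rightarrow> 'a set \<Rightarrow> 'a set mla" where
  "mla_quotient G H =
     \<lparr>carrier = rcosets\<^bsub>G\<^esub> H, monoid.mult = set_mult G, one = H,
      lie = (\<lambda>A B. \<Union>a\<in>A. \<Union>b\<in>B. H #>\<^bsub>G\<^esub> (a \<star>\<^bsub>G\<^esub> b))\<rparr>"


section \<open>Commutators, perfectness, centers\<close>

definition lie_subgroup :: "('a, 'm) mla_scheme \<Rightarrow> 'a set \<Rightarrow> 'a set \<Rightarrow> 'a set" where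
  "lie_subgroup G A B = generate G {a \<star>\<^bsub>G\<^esub> b | a b. a \<in> A \<and> b \<in> B}"

definition commutator_subgroup :: "('a, 'm) monoid_scheme \<Rightarrow> 'a set \<Rightarrow> 'a set \<Rightarrow> 'a set" where
  "commutator_subgroup G A B =
     generate G {a \<otimes>\<^bsub>G\<^esub> b \<otimes>\<^bsub>G\<^esub> inv\<^bsub>G\<^esub> a \<otimes>\<^bsub>G\<^esub> inv\<^bsub>G\<^esub> b | a b. a \<in> A \<and> b \<in> B}"

definition mla_commutator :: "('a, 'm) mla_scheme \<Rightarrow> 'a set \<Rightarrow> 'a set \<Rightarrow> 'a set" where
  "mla_commutator G A B = lie_subgroup G A B <#>\<^bsub>G\<^esub> commutator_subgroup G A B"

definition mla_perfect :: "('a, 'm) mla_scheme \<Rightarrow> bool" where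
  "mla_perfect G \<longleftrightarrow> mla_commutator G (carrier G) (carrier G) = carrier G"

definition group_center :: "('a, 'm) monoid_scheme \<Rightarrow> 'a set" where
  "group_center G = {x \<in> carrier G. \<forall>y\<in>carrier G. x \<otimes>\<^bsub>G\<^esub> y = y \<otimes>\<^bsub>G\<^esub> x}"

definition lie_center :: "('a, 'm) mla_scheme \<Rightarrow> 'a set" where
  "lie_center G = {x \<in> carrier G. \<forall>y\<in>carrier G. x \<star>\<^bsub>G\<^esub> y = \<one>\<^bsub>G\<^esub>}"

definition mla_center :: "('a, 'm) mla_scheme \<Rightarrow> 'a set" where
  "mla_center G = lie_center G \<inter> group_center G"


section \<open>Free presentations and the Schur multiplier\<close>

definition free_mla :: "'u mla \<Rightarrow> 'u set \<Rightarrow> bool" where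
  "free_mla F B \<longleftrightarrow> mult_lie_algebra F \<and> B \<subseteq> carrier F \<and>
     (\<forall>(H :: 'u mla) f. mult_lie_algebra H \<and> f \<in> B \<rightarrow> carrier H \<longrightarrow>
        (\<exists>!h. h \<in> mla_hom F H \<and> h \<in> extensional (carrier F) \<and> (\<forall>x\<in>B. h x = f x)))"

text \<open>In a short exact sequence \<open>1 \<rightarrow> N \<rightarrow> E \<rightarrow> G \<rightarrow> 1\<close> the first term is identified with its
  image in \<open>E\<close>, that is, with the kernel of the map \<open>E \<rightarrow> G\<close>.\<close>

definition mla_short_exact ::
  "'a set \<Rightarrow> ('a, 'm) mla_scheme \<Rightarrow> ('a \<Rightarrow> 'b) \<Rightarrow> ('b, 'n) mla_scheme \<Rightarrow> bool" where
  "mla_short_exact N E \<phi> G \<longleftrightarrow> mult_lie_algebra E \<and> mult_lie_algebra G \<and>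
     \<phi> \<in> mla_hom E G \<and> \<phi> ` carrier E = carrier G \<and> N = kernel E G \<phi>"

definition free_presentation ::
  "'u set \<Rightarrow> 'u mla \<Rightarrow> 'u set \<Rightarrow> ('u \<Rightarrow> 'u) \<Rightarrow> 'u mla \<Rightarrow> bool" where
  "free_presentation R F B \<pi> G \<longleftrightarrow> free_mla F B \<and> mla_short_exact R F \<pi> G"

text \<open>The Schur multiplier of \<open>F/R\<close>, computed from the given free presentation.\<close>

definition schur_multiplier :: "'a set \<Rightarrow> 'a mla \<Rightarrow> 'a set mla" where
  "schur_multiplier R F =
     mla_quotient (F\<lparr>carrier := mla_commutator F (carrier F) (carrier F) \<inter> R\<rparr>)
       (mla_commutator F R (carrier F))"


section \<open>Central extensions\<close>

definition central_extension ::
  "'a set \<Rightarrow> ('a, 'm) mla_scheme \<Rightarrow> ('a \<Rightarrow> 'b) \<Rightarrow> ('b, 'n) mla_scheme \<Rightarrow> bool" where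
  "central_extension N E \<phi> G \<longleftrightarrow> mla_short_exact N E \<phi> G \<and> N \<subseteq> mla_center E"

definition universal_central_extension ::
  "'u set \<Rightarrow> 'u mla \<Rightarrow> ('u \<Rightarrow> 'u) \<Rightarrow> 'u mla \<Rightarrow> bool" where
  "universal_central_extension N E \<phi> G \<longleftrightarrow> central_extension N E \<phi> G \<and>
     (\<forall>H (K :: 'u mla) \<psi>. central_extension H K \<psi> G \<longrightarrow>
        (\<exists>!\<theta>. \<theta> \<in> mla_hom E K \<and> \<theta> \<in> extensional (carrier E) \<and>
              (\<forall>x\<in>carrier E. \<psi> (\<theta> x) = \<phi> x)))"

definition stem_extension ::
  "'a set \<Rightarrow> ('a, 'm) mla_scheme \<Rightarrow> ('a \<Rightarrow> 'b) \<Rightarrow> ('b, 'n) mla_scheme \<Rightarrow> bool" where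
  "stem_extension N E \<phi> G \<longleftrightarrow> central_extension N E \<phi> G \<and>
     N \<subseteq> mla_commutator E (carrier E) (carrier E)"

text \<open>The last two arguments are the kernel \<open>R\<close> and the middle term \<open>F\<close> of a free presentation
  of \<open>G\<close> from which the Schur multiplier of \<open>G\<close> is computed. A cover of \<open>G\<close> is the middle term of a
  stem cover.\<close>

definition stem_cover ::
  "'a set \<Rightarrow> 'a mla \<Rightarrow> ('a \<Rightarrow> 'b) \<Rightarrow> 'b mla \<Rightarrow> 'c set \<Rightarrow> 'c mla \<Rightarrow> bool" where
  "stem_cover N E \<phi> G R F \<longleftrightarrow> stem_extension N E \<phi> G \<and>
     mla_isomorphic (E\<lparr>carrier := N\<rparr>) (schur_multiplier R F)"

definition is_cover :: "'a mla \<Rightarrow> 'b mla \<Rightarrow> 'c set \<Rightarrow> 'c mla \<Rightarrow> bool" where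
  "is_cover E G R F \<longleftrightarrow> (\<exists>N \<phi>. stem_cover N E \<phi> G R F)"

end

theory Submission
  imports Defs "HOL-Algebra.SndIsomorphismGrp"
begin

text \<open>Let \<open>H\<close> and \<open>P\<close> be the commutator ideals of \<open>R, F\<close> and of \<open>F, F\<close>. Lift \<open>\<pi>\<close> to
  \<open>h : F \<rightarrow> Gs\<close> by freeness. Since \<open>Gs\<close> is perfect and generated by \<open>h F\<close> modulo its center,
  \<open>h\<close> maps \<open>P\<close> onto \<open>Gs\<close>, hence \<open>P \<inter> R\<close> onto \<open>N\<close>. Universality gives \<open>\<theta> : Gs \<rightarrow> F/H\<close> over \<open>G\<close>.
  Two homomorphisms into a central extension that agree over \<open>G\<close> agree on commutators, so
  \<open>\<theta> \<circ> h\<close> is the quotient map on \<open>P\<close>; thus the kernel of \<open>h\<close> on \<open>P \<inter> R\<close> is exactly \<open>H\<close>.\<close>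

section \<open>Elementary identities\<close>

context mult_lie_algebra
begin

lemma conj_by_closed [simp]:
  "\<lbrakk>x \<in> carrier G; y \<in> carrier G\<rbrakk> \<Longrightarrow> conj_by G x y \<in> carrier G"
  by (simp add: conj_by_def)

lemma conj_by_one [simp]: "x \<in> carrier G \<Longrightarrow> conj_by G x \<one> = \<one>"
  by (simp add: conj_by_def)

lemma conj_by_mult:
  assumes "x \<in> carrier G" "y \<in> carrier G" "z \<in> carrier G"
  shows "conj_by G x (y \<otimes> z) = conj_by G x y \<otimes> conj_by G x z"
proof -
  have "inv x \<otimes> (x \<otimes> (z \<otimes> inv x)) = z \<otimes> inv x"
    using assms by (simp flip: m_assoc)
  then show ?thesis
    using assms by (simp add: conj_by_def m_assoc)
qed

lemma conj_by_eq_one_iff [simp]: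
  assumes "x \<in> carrier G" "y \<in> carrier G"
  shows "conj_by G x y = \<one> \<longleftrightarrow> y = \<one>"
proof
  assume "conj_by G x y = \<one>"
  then have "x \<otimes> y = x"
    using assms inv_equality [of "x \<otimes> y" "inv x"] by (simp add: conj_by_def)
  then show "y = \<one>"
    using assms by simp
qed (use assms in simp)

declare lie_closed [simp]

text \<open>Expanding \<open>(x \<otimes> y) \<star> (x \<otimes> y) = \<one>\<close> first on the
  left and then on the right kills the two self-brackets. What remains is the conjugate by
  \<open>x\<close> of the claimed product.\<close>

lemma lie_mult_flip:
  assumes x: "x \<in> carrier G" and y: "y \<in> carrier G"
  shows "(y \<star> x) \<otimes> (x \<star> y) = \<one>"
proof -
  have "\<one> = conj_by G x (y \<star> (x \<otimes> y)) \<otimes> (x \<star> (x \<otimes> y))"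
    using x y lie_mult_left [of x y "x \<otimes> y"] by (simp add: lie_self)
  also have "\<dots> = conj_by G x ((y \<star> x) \<otimes> conj_by G x (y \<star> y)) \<otimes> ((x \<star> x) \<otimes> conj_by G x (x \<star> y))"
    using x y by (simp add: lie_mult_right)
  also have "\<dots> = conj_by G x ((y \<star> x) \<otimes> (x \<star> y))"
    using x y by (simp add: lie_self conj_by_mult)
  finally show ?thesis
    using x y conj_by_eq_one_iff [of x "(y \<star> x) \<otimes> (x \<star> y)"] by simp
qed

lemma inv_lie: "\<lbrakk>x \<in> carrier G; y \<in> carrier G\<rbrakk> \<Longrightarrow> inv (x \<star> y) = y \<star> x"
  using lie_mult_flip by (simp add: inv_equality)

section \<open>Central elements and brackets modulo the center\<close>

lemma mla_center_subset: "mla_center G \<subseteq> carrier G"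
  by (auto simp: mla_center_def group_center_def)

text \<open>The definition of \<open>lie_center\<close> constrains only the left argument;
  antisymmetry carries this over to the right one.\<close>

lemma lie_mla_center:
  assumes z: "z \<in> mla_center G" and x: "x \<in> carrier G"
  shows "z \<star> x = \<one>" "x \<star> z = \<one>"
proof -
  show "z \<star> x = \<one>"
    using z x by (simp add: mla_center_def lie_center_def)
  moreover have "z \<in> carrier G"
    using z mla_center_subset by blast
  ultimately show "x \<star> z = \<one>"
    using lie_mult_flip [OF x, of z] x by simp
qed

lemma mult_mla_center:
  "\<lbrakk>z \<in> mla_center G; x \<in> carrier G\<rbrakk> \<Longrightarrow> z \<otimes> x = x \<otimes> z"
  by (simp add: mla_center_def group_center_def)

lemma conj_by_mla_center:
  assumes "z \<in> mla_center G" "x \<in> carrier G"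
  shows "conj_by G z x = x"
proof -
  have "z \<in> carrier G"
    using assms mla_center_subset by auto
  then show ?thesis
    unfolding conj_by_def mult_mla_center [OF assms] using assms(2) by (simp add: m_assoc)
qed

text \<open>The two product laws split off only brackets with a central argument, which are trivial,
  and conjugations by central elements, which are the identity. So the bracket depends only on
  classes modulo the center.\<close>

lemma lie_mult_mla_center:
  assumes zw: "z \<in> mla_center G" "w \<in> mla_center G" and xy: "x \<in> carrier G" "y \<in> carrier G"
  shows "(z \<otimes> x) \<star> (w \<otimes> y) = x \<star> y"
proof -
  have "z \<in> carrier G" "w \<in> carrier G"
    using zw mla_center_subset by auto
  then show ?thesis
    using zw xy by (simp add: lie_mult_left lie_mult_right lie_mla_center conj_by_mla_center)
qed

lemma commutator_mult_mla_center:
  assumes zw: "z \<in> mla_center G" "w \<in> mla_center G" and xy: "x \<in> carrier G" "y \<in> carrier G"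
  shows "(z \<otimes> x) \<otimes> (w \<otimes> y) \<otimes> inv (z \<otimes> x) \<otimes> inv (w \<otimes> y) = x \<otimes> y \<otimes> inv x \<otimes> inv y"
proof -
  have c: "z \<in> carrier G" "w \<in> carrier G"
    using zw mla_center_subset by auto
  \<comment> \<open>The commutator of two elements is the conjugate of the second by the first,
    times the inverse of the second; the central factor \<open>z\<close> disappears from this
    conjugation.\<close>
  have "conj_by G (z \<otimes> x) (w \<otimes> y) = conj_by G z (conj_by G x (w \<otimes> y))"
    using c xy by (simp add: conj_by_def inv_mult_group m_assoc)
  also have "\<dots> = conj_by G x w \<otimes> conj_by G x y"
    using c xy zw by (simp add: conj_by_mla_center conj_by_mult)
  also have "conj_by G x w = w"
    using c xy mult_mla_center [OF zw(2) xy(1), symmetric] by (simp add: conj_by_def m_assoc)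
  \<comment> \<open>The factor \<open>w\<close> in front and its inverse at the end form a
    conjugation by a central element.\<close>
  finally have "conj_by G (z \<otimes> x) (w \<otimes> y) \<otimes> inv (w \<otimes> y) = conj_by G w (conj_by G x y \<otimes> inv y)"
    using c xy by (simp add: conj_by_def inv_mult_group m_assoc)
  also have "\<dots> = conj_by G x y \<otimes> inv y"
    using c xy zw by (simp add: conj_by_mla_center)
  finally show ?thesis
    by (simp add: conj_by_def)
qed


section \<open>Commutators of normal subgroups\<close>

text \<open>By \<open>lie_conj\<close>, conjugation sends a generator \<open>a \<star> b\<close> to
  the bracket of the conjugates, which stay in \<open>A\<close> and \<open>B\<close>; a
  conjugation-stable set generates a normal subgroup.\<close>

lemma lie_subgroup_normal:
  assumes A: "A \<lhd> G" and B: "B \<lhd> G"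
  shows "lie_subgroup G A B \<lhd> G"
  unfolding lie_subgroup_def
proof (rule normal_generateI)
  have sub: "A \<subseteq> carrier G" "B \<subseteq> carrier G"
    using A B by (auto dest!: normal_imp_subgroup subgroup.subset)
  then show "{a \<star> b |a b. a \<in> A \<and> b \<in> B} \<subseteq> carrier G"
    by (auto simp: subset_iff)
  fix h g
  assume "h \<in> {a \<star> b |a b. a \<in> A \<and> b \<in> B}" and g: "g \<in> carrier G"
  then obtain a b where ab: "a \<in> A" "b \<in> B" "h = a \<star> b"
    by auto
  then have "g \<otimes> h \<otimes> inv g = conj_by G g a \<star> conj_by G g b"
    using lie_conj [of a b g] sub g by (auto simp: conj_by_def)
  moreover have "conj_by G g a \<in> A" "conj_by G g b \<in> B"
    using ab g A B by (simp_all add: conj_by_def normal.inv_op_closed2)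
  ultimately show "g \<otimes> h \<otimes> inv g \<in> {a \<star> b |a b. a \<in> A \<and> b \<in> B}"
    by blast
qed

lemma commutator_subgroup_normal:
  assumes A: "A \<lhd> G" and B: "B \<lhd> G"
  shows "commutator_subgroup G A B \<lhd> G"
  unfolding commutator_subgroup_def
proof (rule normal_generateI)
  have sub: "A \<subseteq> carrier G" "B \<subseteq> carrier G"
    using A B by (auto dest!: normal_imp_subgroup subgroup.subset)
  then show "{a \<otimes> b \<otimes> inv a \<otimes> inv b |a b. a \<in> A \<and> b \<in> B} \<subseteq> carrier G"
    by (auto simp: subset_iff)
  fix h g
  assume "h \<in> {a \<otimes> b \<otimes> inv a \<otimes> inv b |a b. a \<in> A \<and> b \<in> B}" and g: "g \<in> carrier G"
  then obtain a b where ab: "a \<in> A" "b \<in> B" "h = a \<otimes> b \<otimes> inv a \<otimes> inv b"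
    by auto
  let ?a = "conj_by G g a" and ?b = "conj_by G g b"
  have c: "a \<in> carrier G" "b \<in> carrier G"
    using ab sub by auto
  have inv: "inv conj_by G g x = conj_by G g (inv x)" if "x \<in> carrier G" for x
    using that g by (simp add: conj_by_def inv_mult_group m_assoc)
  have "conj_by G g h = ?a \<otimes> ?b \<otimes> inv ?a \<otimes> inv ?b"
    using c g by (simp add: ab(3) conj_by_mult inv)
  moreover have "?a \<in> A" "?b \<in> B"
    using ab g A B by (simp_all add: conj_by_def normal.inv_op_closed2)
  ultimately show "g \<otimes> h \<otimes> inv g \<in> {a \<otimes> b \<otimes> inv a \<otimes> inv b |a b. a \<in> A \<and> b \<in> B}"
    unfolding conj_by_def by blast
qed

lemma mla_commutator_normal:
  assumes "A \<lhd> G" "B \<lhd> G"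
  shows "mla_commutator G A B \<lhd> G"
  unfolding mla_commutator_def
  by (rule normal_subgroup_set_mult_closed
      [OF lie_subgroup_normal [OF assms] commutator_subgroup_normal [OF assms]])

lemma carrier_normal: "carrier G \<lhd> G"
  by (rule normal_invI [OF subgroup_self]) simp

text \<open>\<open>S\<close> is closed under products, so it absorbs the set product once it
  contains both kinds of generators. Inclusions of commutator ideals are thereby reduced to
  generators.\<close>

lemma mla_commutator_least:
  assumes S: "subgroup S G"
    and "\<And>a b. \<lbrakk>a \<in> A; b \<in> B\<rbrakk> \<Longrightarrow> a \<star> b \<in> S"
    and "\<And>a b. \<lbrakk>a \<in> A; b \<in> B\<rbrakk> \<Longrightarrow> a \<otimes> b \<otimes> inv a \<otimes> inv b \<in> S"
  shows "mla_commutator G A B \<subseteq> S"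
proof -
  have "lie_subgroup G A B \<subseteq> S" "commutator_subgroup G A B \<subseteq> S"
    unfolding lie_subgroup_def commutator_subgroup_def
    by (rule generate_subgroup_incl [OF _ S], use assms(2,3) in blast)+
  then show ?thesis
    unfolding mla_commutator_def set_mult_def using subgroup.m_closed [OF S] by blast
qed

lemma mla_commutator_mem:
  assumes sub: "A \<subseteq> carrier G" "B \<subseteq> carrier G" and a: "a \<in> A" and b: "b \<in> B"
  shows "a \<star> b \<in> mla_commutator G A B" "a \<otimes> b \<otimes> inv a \<otimes> inv b \<in> mla_commutator G A B"
proof -
  have l: "a \<star> b \<in> lie_subgroup G A B" and c: "a \<otimes> b \<otimes> inv a \<otimes> inv b \<in> commutator_subgroup G A B"
    unfolding lie_subgroup_def commutator_subgroup_def using a b by (blast intro: generate.incl)+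
  have o: "\<one> \<in> lie_subgroup G A B" "\<one> \<in> commutator_subgroup G A B"
    unfolding lie_subgroup_def commutator_subgroup_def by (rule generate.one)+
  have "a \<in> carrier G" "b \<in> carrier G"
    using assms by auto
  then have "a \<star> b = a \<star> b \<otimes> \<one>"
    "a \<otimes> b \<otimes> inv a \<otimes> inv b = \<one> \<otimes> (a \<otimes> b \<otimes> inv a \<otimes> inv b)"
    by simp_all
  with l c o show "a \<star> b \<in> mla_commutator G A B"
    "a \<otimes> b \<otimes> inv a \<otimes> inv b \<in> mla_commutator G A B"
    unfolding mla_commutator_def set_mult_def by blast+
qed

text \<open>Makes the derived ideal an algebra inside the same type, to which the universal property
  can be applied.\<close>

lemma mult_lie_algebra_subgroup:
  assumes S: "subgroup S G" and lie: "\<And>x y. \<lbrakk>x \<in> S; y \<in> S\<rbrakk> \<Longrightarrow> x \<star> y \<in> S"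
  shows "mult_lie_algebra (G\<lparr>carrier := S\<rparr>)"
proof -
  interpret S: group "G\<lparr>carrier := S\<rparr>"
    by (rule subgroup_imp_group [OF S])
  have c: "x \<in> carrier G" if "x \<in> S" for x
    using that subgroup.subset [OF S] by auto
  have conj: "conj_by (G\<lparr>carrier := S\<rparr>) x y = conj_by G x y" if "x \<in> S" for x y
    using that S by (simp add: conj_by_def)
  show ?thesis
    by unfold_locales
      (simp_all add: lie conj c lie_self lie_mult_right lie_mult_left lie_jacobi lie_conj)
qed

end


section \<open>Homomorphisms\<close>

lemma mla_hom_closed: "\<lbrakk>h \<in> mla_hom G K; x \<in> carrier G\<rbrakk> \<Longrightarrow> h x \<in> carrier K"
  by (auto simp: mla_hom_def hom_def)

lemma mla_hom_mult:
  "\<lbrakk>h \<in> mla_hom G K; x \<in> carrier G; y \<in> carrier G\<rbrakk> \<Longrightarrow> h (x \<otimes>\<^bsub>G\<^esub> y) = h x \<otimes>\<^bsub>K\<^esub> h y"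
  by (auto simp: mla_hom_def hom_def)

lemma mla_hom_lie:
  "\<lbrakk>h \<in> mla_hom G K; x \<in> carrier G; y \<in> carrier G\<rbrakk> \<Longrightarrow> h (x \<star>\<^bsub>G\<^esub> y) = h x \<star>\<^bsub>K\<^esub> h y"
  by (auto simp: mla_hom_def)

lemma mla_hom_group_hom:
  "\<lbrakk>mult_lie_algebra G; mult_lie_algebra K; h \<in> mla_hom G K\<rbrakk> \<Longrightarrow> group_hom G K h"
  by (simp add: group_hom_def group_hom_axioms_def mla_hom_def mult_lie_algebra.axioms(1))

lemma mla_hom_compose:
  "\<lbrakk>mult_lie_algebra G; f \<in> mla_hom G H; g \<in> mla_hom H K\<rbrakk> \<Longrightarrow> g \<circ> f \<in> mla_hom G K"
  by (auto simp: mla_hom_def hom_def Pi_iff)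

lemma mla_hom_restrict:
  assumes "mult_lie_algebra G" "f \<in> mla_hom G K"
  shows "restrict f (carrier G) \<in> mla_hom G K"
proof -
  interpret mult_lie_algebra G by fact
  show ?thesis
    using assms(2) by (auto simp: mla_hom_def hom_def)
qed

text \<open>All axioms are identities apart from the existence of inverses, so they pass to a
  surjective image. Since \<open>K\<close> is not yet known to be a group, preservation of the unit
  is a hypothesis of its own.\<close>

lemma mult_lie_algebra_image:
  assumes G: "mult_lie_algebra G" and h: "h \<in> mla_hom G K"
    and onto: "h ` carrier G = carrier K" and one: "h \<one>\<^bsub>G\<^esub> = \<one>\<^bsub>K\<^esub>"
  shows "mult_lie_algebra K"
proof -
  interpret G: mult_lie_algebra G by fact
  have pre: "\<exists>x\<in>carrier G. y = h x" if "y \<in> carrier K" for y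
    using that onto by auto
  note hs = mla_hom_mult [OF h, symmetric] mla_hom_lie [OF h, symmetric]
  interpret K: group K
  proof (rule groupI)
    show "\<one>\<^bsub>K\<^esub> \<in> carrier K"
      using mla_hom_closed [OF h, of "\<one>\<^bsub>G\<^esub>"] one by simp
  next
    fix x y assume "x \<in> carrier K" "y \<in> carrier K"
    then show "x \<otimes>\<^bsub>K\<^esub> y \<in> carrier K"
      by (auto dest!: pre simp: hs mla_hom_closed [OF h])
  next
    fix x y z assume "x \<in> carrier K" "y \<in> carrier K" "z \<in> carrier K"
    then show "x \<otimes>\<^bsub>K\<^esub> y \<otimes>\<^bsub>K\<^esub> z = x \<otimes>\<^bsub>K\<^esub> (y \<otimes>\<^bsub>K\<^esub> z)"
      by (auto dest!: pre simp: hs G.m_assoc)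
  next
    fix x assume "x \<in> carrier K"
    then obtain a where a: "a \<in> carrier G" "x = h a"
      using pre by blast
    then show "\<one>\<^bsub>K\<^esub> \<otimes>\<^bsub>K\<^esub> x = x"
      by (simp add: hs flip: one)
    have "h (inv\<^bsub>G\<^esub> a) \<otimes>\<^bsub>K\<^esub> x = \<one>\<^bsub>K\<^esub>"
      using a by (simp add: hs one)
    then show "\<exists>y\<in>carrier K. y \<otimes>\<^bsub>K\<^esub> x = \<one>\<^bsub>K\<^esub>"
      using a mla_hom_closed [OF h] by blast
  qed
  interpret group_hom G K h
    using h by unfold_locales (simp add: mla_hom_def)
  have conj: "conj_by K (h x) (h y) = h (conj_by G x y)"
    if "x \<in> carrier G" "y \<in> carrier G" for x y
    using that by (simp add: conj_by_def)
  show ?thesis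
  proof
    fix x y assume "x \<in> carrier K" "y \<in> carrier K"
    then show "x \<star>\<^bsub>K\<^esub> y \<in> carrier K"
      by (auto dest!: pre simp: hs(2))
  next
    fix x assume "x \<in> carrier K"
    then show "x \<star>\<^bsub>K\<^esub> x = \<one>\<^bsub>K\<^esub>"
      by (auto dest!: pre simp: hs(2) G.lie_self)
  next
    fix x y z assume "x \<in> carrier K" "y \<in> carrier K" "z \<in> carrier K"
    then obtain a b c where abc: "a \<in> carrier G" "b \<in> carrier G" "c \<in> carrier G"
      and [simp]: "x = h a" "y = h b" "z = h c"
      by (auto dest!: pre)
    show "x \<star>\<^bsub>K\<^esub> (y \<otimes>\<^bsub>K\<^esub> z) = (x \<star>\<^bsub>K\<^esub> y) \<otimes>\<^bsub>K\<^esub> conj_by K y (x \<star>\<^bsub>K\<^esub> z)"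
      using abc G.lie_mult_right [OF abc] by (simp add: hs conj del: hom_mult)
    show "(x \<otimes>\<^bsub>K\<^esub> y) \<star>\<^bsub>K\<^esub> z = conj_by K x (y \<star>\<^bsub>K\<^esub> z) \<otimes>\<^bsub>K\<^esub> (x \<star>\<^bsub>K\<^esub> z)"
      using abc G.lie_mult_left [OF abc] by (simp add: hs conj del: hom_mult)
    show "((x \<star>\<^bsub>K\<^esub> y) \<star>\<^bsub>K\<^esub> conj_by K y z) \<otimes>\<^bsub>K\<^esub> ((y \<star>\<^bsub>K\<^esub> z) \<star>\<^bsub>K\<^esub> conj_by K z x)
        \<otimes>\<^bsub>K\<^esub> ((z \<star>\<^bsub>K\<^esub> x) \<star>\<^bsub>K\<^esub> conj_by K x y) = \<one>\<^bsub>K\<^esub>"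
      using abc G.lie_jacobi [OF abc] by (simp add: hs conj one del: hom_mult)
    show "conj_by K z (x \<star>\<^bsub>K\<^esub> y) = conj_by K z x \<star>\<^bsub>K\<^esub> conj_by K z y"
      using abc G.lie_conj [OF abc] by (simp add: hs conj del: hom_mult)
  qed
qed

lemma mla_hom_eq_on_commutator:
  assumes X: "mult_lie_algebra X" and E: "mult_lie_algebra E"
    and f: "f \<in> mla_hom X E" and g: "g \<in> mla_hom X E"
    and central: "\<And>x. x \<in> carrier X \<Longrightarrow> \<exists>z\<in>mla_center E. f x = z \<otimes>\<^bsub>E\<^esub> g x"
    and x: "x \<in> mla_commutator X (carrier X) (carrier X)"
  shows "f x = g x"
proof -
  interpret X: mult_lie_algebra X by fact
  interpret E: mult_lie_algebra E by fact
  interpret f: group_hom X E f by (rule mla_hom_group_hom) fact+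
  interpret g: group_hom X E g by (rule mla_hom_group_hom) fact+
  \<comment> \<open>The equalizer of \<open>f\<close> and \<open>g\<close> is a subgroup, and it
    contains brackets and commutators because these ignore central factors in
    \<open>E\<close>.\<close>
  have "mla_commutator X (carrier X) (carrier X) \<subseteq> {x \<in> carrier X. f x = g x}"
  proof (rule X.mla_commutator_least)
    show "subgroup {x \<in> carrier X. f x = g x} X"
      by (rule X.subgroupI) auto
    fix a b assume ab: "a \<in> carrier X" "b \<in> carrier X"
    then obtain z w where zw: "z \<in> mla_center E" "w \<in> mla_center E"
      "f a = z \<otimes>\<^bsub>E\<^esub> g a" "f b = w \<otimes>\<^bsub>E\<^esub> g b"
      using central by meson
    show "a \<star>\<^bsub>X\<^esub> b \<in> {x \<in> carrier X. f x = g x}"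
      using ab zw by (simp add: mla_hom_lie [OF f] mla_hom_lie [OF g] E.lie_mult_mla_center)
    show "a \<otimes>\<^bsub>X\<^esub> b \<otimes>\<^bsub>X\<^esub> inv\<^bsub>X\<^esub> a \<otimes>\<^bsub>X\<^esub> inv\<^bsub>X\<^esub> b \<in> {x \<in> carrier X. f x = g x}"
      using ab zw E.commutator_mult_mla_center [OF zw(1,2), of "g a" "g b"] by simp
  qed
  with x show ?thesis
    by blast
qed

text \<open>Elements of \<open>E\<close> may be replaced by images under \<open>h\<close> inside
  brackets and commutators, since central factors do not change them. Hence surjectivity modulo the
  center is enough.\<close>

lemma mla_commutator_subset_image:
  assumes X: "mult_lie_algebra X" and E: "mult_lie_algebra E" and h: "h \<in> mla_hom X E"
    and onto: "\<And>y. y \<in> carrier E \<Longrightarrow> \<exists>z\<in>mla_center E. \<exists>x\<in>carrier X. y = z \<otimes>\<^bsub>E\<^esub> h x"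
  shows "mla_commutator E (carrier E) (carrier E) \<subseteq> h ` mla_commutator X (carrier X) (carrier X)"
proof -
  interpret X: mult_lie_algebra X by fact
  interpret E: mult_lie_algebra E by fact
  interpret group_hom X E h by (rule mla_hom_group_hom) fact+
  show ?thesis
  proof (rule E.mla_commutator_least)
    show "subgroup (h ` mla_commutator X (carrier X) (carrier X)) E"
      by (intro subgroup_img_is_subgroup normal_imp_subgroup X.mla_commutator_normal X.carrier_normal)
    fix a b assume "a \<in> carrier E" "b \<in> carrier E"
    then obtain z w x y where zw: "z \<in> mla_center E" "w \<in> mla_center E"
      and xy: "x \<in> carrier X" "y \<in> carrier X" and ab: "a = z \<otimes>\<^bsub>E\<^esub> h x" "b = w \<otimes>\<^bsub>E\<^esub> h y"
      using onto by meson
    have "a \<star>\<^bsub>E\<^esub> b = h (x \<star>\<^bsub>X\<^esub> y)"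
      using xy zw by (simp add: ab mla_hom_lie [OF h] E.lie_mult_mla_center)
    then show "a \<star>\<^bsub>E\<^esub> b \<in> h ` mla_commutator X (carrier X) (carrier X)"
      using X.mla_commutator_mem(1) xy by blast
    have "a \<otimes>\<^bsub>E\<^esub> b \<otimes>\<^bsub>E\<^esub> inv\<^bsub>E\<^esub> a \<otimes>\<^bsub>E\<^esub> inv\<^bsub>E\<^esub> b
        = h (x \<otimes>\<^bsub>X\<^esub> y \<otimes>\<^bsub>X\<^esub> inv\<^bsub>X\<^esub> x \<otimes>\<^bsub>X\<^esub> inv\<^bsub>X\<^esub> y)"
      using xy E.commutator_mult_mla_center [OF zw, of "h x" "h y"] by (simp add: ab)
    then show "a \<otimes>\<^bsub>E\<^esub> b \<otimes>\<^bsub>E\<^esub> inv\<^bsub>E\<^esub> a \<otimes>\<^bsub>E\<^esub> inv\<^bsub>E\<^esub> b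
        \<in> h ` mla_commutator X (carrier X) (carrier X)"
      using X.mla_commutator_mem(2) xy by blast
  qed
qed

lemma mla_commutator_kernel:
  assumes X: "mult_lie_algebra X" and E: "mult_lie_algebra E" and h: "h \<in> mla_hom X E"
    and R: "R \<subseteq> carrier X" "h ` R \<subseteq> mla_center E"
  shows "mla_commutator X R (carrier X) \<subseteq> kernel X E h"
proof -
  interpret X: mult_lie_algebra X by fact
  interpret E: mult_lie_algebra E by fact
  interpret group_hom X E h by (rule mla_hom_group_hom) fact+
  show ?thesis
  proof (rule X.mla_commutator_least [OF subgroup_kernel])
    fix a b assume "a \<in> R" and b: "b \<in> carrier X"
    then have a: "a \<in> carrier X" "h a \<in> mla_center E"
      using R by auto
    show "a \<star>\<^bsub>X\<^esub> b \<in> kernel X E h"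
      using a b by (simp add: kernel_def mla_hom_lie [OF h] E.lie_mla_center)
    show "a \<otimes>\<^bsub>X\<^esub> b \<otimes>\<^bsub>X\<^esub> inv\<^bsub>X\<^esub> a \<otimes>\<^bsub>X\<^esub> inv\<^bsub>X\<^esub> b \<in> kernel X E h"
      \<comment> \<open>Conjugating \<open>h b\<close> by the central element \<open>h a\<close>
        changes nothing, so the image of the commutator is trivial.\<close>
      using a b E.conj_by_mla_center [of "h a" "h b"] by (simp add: kernel_def conj_by_def)
  qed
qed

section \<open>Quotients on coset representatives\<close>

text \<open>The universal property of \<open>Gs\<close> only sees algebras inside \<open>'u\<close>, so \<open>F/[R,F]\<close>
  is realised on a transversal of the cosets instead of on the type \<open>'u set\<close>.\<close>

definition coset_rep :: "('a, 'm) monoid_scheme \<Rightarrow> 'a set \<Rightarrow> 'a \<Rightarrow> 'a" where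
  "coset_rep G H x = (SOME y. y \<in> H #>\<^bsub>G\<^esub> x)"

definition rep_quotient :: "'a mla \<Rightarrow> 'a set \<Rightarrow> 'a mla" where
  "rep_quotient G H =
     \<lparr>carrier = coset_rep G H ` carrier G,
      monoid.mult = (\<lambda>a b. coset_rep G H (a \<otimes>\<^bsub>G\<^esub> b)),
      one = coset_rep G H \<one>\<^bsub>G\<^esub>,
      lie = (\<lambda>a b. coset_rep G H (a \<star>\<^bsub>G\<^esub> b))\<rparr>"

locale mla_ideal = mult_lie_algebra G + normal H G for H and G :: "'a mla" (structure) +
  assumes lie_ideal: "\<lbrakk>x \<in> carrier G; y \<in> H\<rbrakk> \<Longrightarrow> x \<star> y \<in> H"
begin

lemma lie_ideal_left:
  assumes "y \<in> H" "x \<in> carrier G"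
  shows "y \<star> x \<in> H"
proof -
  have "inv (x \<star> y) \<in> H"
    using assms lie_ideal by simp
  then show ?thesis
    using assms by (simp add: inv_lie)
qed

lemma coset_rep_mem: "x \<in> carrier G \<Longrightarrow> coset_rep G H x \<in> H #> x"
  unfolding coset_rep_def using rcos_self [OF _ subgroup_axioms] by (rule someI)

lemma coset_repE:
  assumes "x \<in> carrier G"
  obtains u where "u \<in> H" "coset_rep G H x = u \<otimes> x"
  using coset_rep_mem [OF assms] by (auto simp: r_coset_def)

text \<open>The choice depends only on the coset as a set, and the two cosets coincide.\<close>

lemma coset_rep_mult_left:
  assumes "u \<in> H" "x \<in> carrier G"
  shows "coset_rep G H (u \<otimes> x) = coset_rep G H x"
proof -
  have "H #> (u \<otimes> x) = H #> x"
    using assms coset_mult_assoc [of H u x] coset_join2 [of u H] subset subgroup_axioms by auto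
  then show ?thesis
    by (simp add: coset_rep_def)
qed

lemma coset_rep_mult_right:
  assumes "u \<in> H" "x \<in> carrier G"
  shows "coset_rep G H (x \<otimes> u) = coset_rep G H x"
proof -
  have "x \<otimes> u = conj_by G x u \<otimes> x"
    using assms by (simp add: conj_by_def m_assoc)
  moreover have "conj_by G x u \<in> H"
    using assms by (simp add: conj_by_def inv_op_closed2)
  ultimately show ?thesis
    using coset_rep_mult_left assms by simp
qed

lemma coset_rep_conj_by:
  assumes "u \<in> H" "x \<in> carrier G"
  shows "coset_rep G H (conj_by G u x) = coset_rep G H x"
  using assms by (simp add: conj_by_def m_assoc coset_rep_mult_left coset_rep_mult_right)

text \<open>The representatives are \<open>u \<otimes> x\<close> and \<open>v \<otimes> y\<close>
  with \<open>u\<close>, \<open>v\<close> in \<open>H\<close>; normality lets \<open>v\<close> move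
  to the left of \<open>x\<close>, where it is absorbed.\<close>

lemma coset_rep_mult:
  assumes x: "x \<in> carrier G" and y: "y \<in> carrier G"
  shows "coset_rep G H (coset_rep G H x \<otimes> coset_rep G H y) = coset_rep G H (x \<otimes> y)"
proof -
  obtain u v where uv: "u \<in> H" "v \<in> H" and eq: "coset_rep G H x = u \<otimes> x" "coset_rep G H y = v \<otimes> y"
    using x y by (metis coset_repE)
  have c: "conj_by G x v \<in> H"
    using uv x by (simp add: conj_by_def inv_op_closed2)
  have "conj_by G x v \<otimes> (x \<otimes> y) = (conj_by G x v \<otimes> x) \<otimes> y"
    using c uv x y by (simp add: m_assoc)
  also have "conj_by G x v \<otimes> x = x \<otimes> v"
    using uv x by (simp add: conj_by_def m_assoc)
  finally have "(u \<otimes> x) \<otimes> (v \<otimes> y) = u \<otimes> (conj_by G x v \<otimes> (x \<otimes> y))"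
    using uv x y by (simp add: m_assoc)
  then show ?thesis
    using uv c x y by (simp add: eq coset_rep_mult_left)
qed

text \<open>Expanding the bracket of \<open>u \<otimes> x\<close> and \<open>v \<otimes> y\<close>
  leaves factors \<open>u \<star> (v \<otimes> y)\<close> and \<open>x \<star> v\<close>, which lie
  in the ideal, and conjugations by \<open>u\<close> and \<open>v\<close>, which preserve
  cosets.\<close>

lemma coset_rep_lie:
  assumes x: "x \<in> carrier G" and y: "y \<in> carrier G"
  shows "coset_rep G H (coset_rep G H x \<star> coset_rep G H y) = coset_rep G H (x \<star> y)"
proof -
  obtain u v where uv: "u \<in> H" "v \<in> H" and eq: "coset_rep G H x = u \<otimes> x" "coset_rep G H y = v \<otimes> y"
    using x y by (metis coset_repE)
  have "coset_rep G H ((u \<otimes> x) \<star> (v \<otimes> y)) = coset_rep G H (conj_by G u (x \<star> (v \<otimes> y)))"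
    using uv x y by (simp add: lie_mult_left coset_rep_mult_right lie_ideal_left)
  also have "\<dots> = coset_rep G H ((x \<star> v) \<otimes> conj_by G v (x \<star> y))"
    using uv x y by (simp add: coset_rep_conj_by lie_mult_right)
  also have "\<dots> = coset_rep G H (x \<star> y)"
    using uv x y by (simp add: coset_rep_mult_left lie_ideal coset_rep_conj_by)
  finally show ?thesis
    by (simp add: eq)
qed

lemma coset_rep_hom: "coset_rep G H \<in> mla_hom G (rep_quotient G H)"
  by (auto simp: mla_hom_def hom_def rep_quotient_def coset_rep_mult coset_rep_lie)

lemma rep_quotient_mult_lie_algebra: "mult_lie_algebra (rep_quotient G H)"
  by (rule mult_lie_algebra_image [OF mult_lie_algebra_axioms coset_rep_hom])
    (simp_all add: rep_quotient_def)

lemma coset_rep_eq_one_iff: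
  assumes x: "x \<in> carrier G"
  shows "coset_rep G H x = \<one>\<^bsub>rep_quotient G H\<^esub> \<longleftrightarrow> x \<in> H"
proof
  assume "coset_rep G H x = \<one>\<^bsub>rep_quotient G H\<^esub>"
  then have "coset_rep G H x \<in> H #> \<one>"
    using coset_rep_mem [of \<one>] by (simp add: rep_quotient_def)
  then have mem: "coset_rep G H x \<in> H"
    using coset_mult_one [OF subset] by simp
  obtain u where u: "u \<in> H" "coset_rep G H x = u \<otimes> x"
    using coset_repE [OF x] .
  then have "inv u \<otimes> (u \<otimes> x) \<in> H"
    using mem by simp
  then show "x \<in> H"
    using u x by (simp flip: m_assoc)
next
  assume "x \<in> H"
  then show "coset_rep G H x = \<one>\<^bsub>rep_quotient G H\<^esub>"
    using coset_rep_mult_left [of x \<one>] by (simp add: rep_quotient_def)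
qed

end

section \<open>Kernels and commutators as ideals\<close>

lemma kernel_ideal:
  assumes F: "mult_lie_algebra F" and G: "mult_lie_algebra G" and f: "f \<in> mla_hom F G"
  shows "mla_ideal (kernel F G f) F"
proof -
  interpret F: mult_lie_algebra F by fact
  interpret G: mult_lie_algebra G by fact
  interpret group_hom F G f by (rule mla_hom_group_hom) fact+
  \<comment> \<open>The right product law at \<open>\<one> \<otimes> \<one>\<close> shows that this
    element equals its own square.\<close>
  have "x \<star>\<^bsub>G\<^esub> \<one>\<^bsub>G\<^esub> = \<one>\<^bsub>G\<^esub>" if "x \<in> carrier G" for x
    using G.lie_mult_right [OF that G.one_closed G.one_closed] that
    by (simp add: conj_by_def)
  then have "mla_ideal_axioms (kernel F G f) F"
    by unfold_locales (auto simp: kernel_def mla_hom_lie [OF f] F.lie_closed)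
  then show ?thesis
    by (intro mla_ideal.intro F normal_kernel)
qed

text \<open>An element \<open>y\<close> of the commutator ideal already lies in \<open>H\<close>, so
  \<open>y \<star> x\<close> is one of its generators; inverting gives
  \<open>x \<star> y\<close>.\<close>

lemma (in mla_ideal) commutator_ideal:
  shows "mla_commutator G H (carrier G) \<subseteq> H" "mla_ideal (mla_commutator G H (carrier G)) G"
proof -
  show sub: "mla_commutator G H (carrier G) \<subseteq> H"
  proof (rule mla_commutator_least [OF subgroup_axioms])
    fix a b assume ab: "a \<in> H" "b \<in> carrier G"
    then show "a \<star> b \<in> H"
      by (rule lie_ideal_left)
    have "a \<otimes> (b \<otimes> inv a \<otimes> inv b) \<in> H"
      using ab by (simp add: inv_op_closed2)
    then show "a \<otimes> b \<otimes> inv a \<otimes> inv b \<in> H"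
      using ab by (simp add: m_assoc)
  qed
  interpret N: normal "mla_commutator G H (carrier G)" G
    by (intro mla_commutator_normal carrier_normal normal_axioms)
  have "x \<star> y \<in> mla_commutator G H (carrier G)"
    if x: "x \<in> carrier G" and y: "y \<in> mla_commutator G H (carrier G)" for x y
  proof -
    have "y \<star> x \<in> mla_commutator G H (carrier G)"
      using mla_commutator_mem(1) [of H "carrier G" y x] subset x y sub by blast
    then have "inv (y \<star> x) \<in> mla_commutator G H (carrier G)"
      by simp
    then show ?thesis
      using x y by (simp add: inv_lie)
  qed
  then show "mla_ideal (mla_commutator G H (carrier G)) G"
    by unfold_locales
qed


section \<open>Central extensions\<close>

text \<open>Modulo \<open>H\<close>, elements of \<open>R\<close> commute with everything and have
  trivial brackets. Representatives are elements of \<open>F\<close> and differ from the original by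
  factors in \<open>R\<close>, so \<pi> itself serves as the projection.\<close>

lemma central_extension_rep_quotient:
  assumes F: "mla_short_exact R F \<pi> G" and H: "H = mla_commutator F R (carrier F)"
  shows "central_extension (kernel (rep_quotient F H) G \<pi>) (rep_quotient F H) \<pi> G"
    and "\<And>x. x \<in> carrier F \<Longrightarrow> \<pi> (coset_rep F H x) = \<pi> x"
proof -
  have FG: "mult_lie_algebra F" "mult_lie_algebra G" and \<pi>: "\<pi> \<in> mla_hom F G"
    and onto: "\<pi> ` carrier F = carrier G" and R: "R = kernel F G \<pi>"
    using F by (simp_all add: mla_short_exact_def)
  interpret R: mla_ideal R F
    unfolding R by (rule kernel_ideal [OF FG \<pi>])
  interpret H: mla_ideal H F
    unfolding H by (rule R.commutator_ideal)
  interpret \<pi>: group_hom F G \<pi>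
    by (rule mla_hom_group_hom [OF FG \<pi>])
  let ?K = "rep_quotient F H" and ?r = "coset_rep F H"
  note r = H.coset_rep_hom
  have HR: "H \<subseteq> R"
    unfolding H by (rule R.commutator_ideal)
  show \<pi>r: "\<pi> (?r x) = \<pi> x" if x: "x \<in> carrier F" for x
  proof -
    obtain u where u: "u \<in> H" "?r x = u \<otimes>\<^bsub>F\<^esub> x"
      using H.coset_repE [OF x] .
    moreover have "u \<in> kernel F G \<pi>"
      using u HR unfolding R by blast
    then have "\<pi> u = \<one>\<^bsub>G\<^esub>"
      by (simp add: kernel_def)
    ultimately show ?thesis
      using x by simp
  qed
  have carrier: "carrier ?K = ?r ` carrier F"
    by (simp add: rep_quotient_def)
  have "\<pi> \<in> mla_hom ?K G"
    unfolding mla_hom_def hom_def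
    by (auto simp: carrier \<pi>r mla_hom_lie [OF \<pi>] simp flip: mla_hom_mult [OF r] mla_hom_lie [OF r])
  moreover have "\<pi> ` carrier ?K = carrier G"
    using \<pi>r by (simp add: carrier image_image flip: onto)
  moreover have "kernel ?K G \<pi> \<subseteq> mla_center ?K"
  proof
    fix k assume "k \<in> kernel ?K G \<pi>"
    then obtain a where "a \<in> carrier F" "k = ?r a" "\<pi> (?r a) = \<one>\<^bsub>G\<^esub>"
      unfolding kernel_def carrier by blast
    then have a: "a \<in> R" "a \<in> carrier F" "k = ?r a"
      unfolding R kernel_def by (simp_all add: \<pi>r)
    have "k \<star>\<^bsub>?K\<^esub> ?r x = \<one>\<^bsub>?K\<^esub>" "k \<otimes>\<^bsub>?K\<^esub> ?r x = ?r x \<otimes>\<^bsub>?K\<^esub> k" if x: "x \<in> carrier F" for x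
    proof -
      have "a \<star>\<^bsub>F\<^esub> x \<in> H"
        unfolding H using R.mla_commutator_mem(1) [of R] R.subset a x by blast
      then show "k \<star>\<^bsub>?K\<^esub> ?r x = \<one>\<^bsub>?K\<^esub>"
        using a x by (simp add: H.coset_rep_eq_one_iff flip: mla_hom_lie [OF r])
      have "a \<otimes>\<^bsub>F\<^esub> x \<otimes>\<^bsub>F\<^esub> inv\<^bsub>F\<^esub> a \<otimes>\<^bsub>F\<^esub> inv\<^bsub>F\<^esub> x \<in> H"
        unfolding H using R.mla_commutator_mem(2) [of R] R.subset a x by blast
      \<comment> \<open>The commutator turns \<open>x \<otimes> a\<close> into
        \<open>a \<otimes> x\<close>, so both products share a representative.\<close>
      then have "?r ((a \<otimes>\<^bsub>F\<^esub> x \<otimes>\<^bsub>F\<^esub> inv\<^bsub>F\<^esub> a \<otimes>\<^bsub>F\<^esub> inv\<^bsub>F\<^esub> x) \<otimes>\<^bsub>F\<^esub> (x \<otimes>\<^bsub>F\<^esub> a)) = ?r (x \<otimes>\<^bsub>F\<^esub> a)"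
        using a x by (simp add: H.coset_rep_mult_left)
      moreover have "(a \<otimes>\<^bsub>F\<^esub> x \<otimes>\<^bsub>F\<^esub> inv\<^bsub>F\<^esub> a \<otimes>\<^bsub>F\<^esub> inv\<^bsub>F\<^esub> x) \<otimes>\<^bsub>F\<^esub> (x \<otimes>\<^bsub>F\<^esub> a) = a \<otimes>\<^bsub>F\<^esub> x"
      proof -
        have "inv\<^bsub>F\<^esub> x \<otimes>\<^bsub>F\<^esub> (x \<otimes>\<^bsub>F\<^esub> a) = a"
          using a x by (simp flip: R.m_assoc)
        then show ?thesis
          using a x by (simp add: R.m_assoc)
      qed
      ultimately show "k \<otimes>\<^bsub>?K\<^esub> ?r x = ?r x \<otimes>\<^bsub>?K\<^esub> k"
        using a x by (simp flip: mla_hom_mult [OF r])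
    qed
    then show "k \<in> mla_center ?K"
      using a by (auto simp: mla_center_def lie_center_def group_center_def carrier)
  qed
  ultimately show "central_extension (kernel ?K G \<pi>) ?K \<pi> G"
    using H.rep_quotient_mult_lie_algebra FG
    by (simp add: central_extension_def mla_short_exact_def)
qed

lemma central_extension_differ_by_center:
  assumes E: "central_extension N E \<phi> G" and a: "a \<in> carrier E" and b: "b \<in> carrier E"
    and eq: "\<phi> a = \<phi> b"
  shows "\<exists>z\<in>mla_center E. a = z \<otimes>\<^bsub>E\<^esub> b"
proof -
  have EG: "mult_lie_algebra E" "mult_lie_algebra G" and \<phi>: "\<phi> \<in> mla_hom E G"
    and N: "kernel E G \<phi> \<subseteq> mla_center E"
    using E by (auto simp: central_extension_def mla_short_exact_def)
  interpret E: mult_lie_algebra E by (rule EG)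
  interpret group_hom E G \<phi> by (rule mla_hom_group_hom [OF EG \<phi>])
  have "a \<otimes>\<^bsub>E\<^esub> inv\<^bsub>E\<^esub> b \<in> kernel E G \<phi>"
    using a b eq by (simp add: kernel_def)
  moreover have "a = (a \<otimes>\<^bsub>E\<^esub> inv\<^bsub>E\<^esub> b) \<otimes>\<^bsub>E\<^esub> b"
    using a b by (simp add: E.m_assoc)
  ultimately show ?thesis
    using N by blast
qed

lemma universal_central_extensionD:
  fixes E K :: "'u mla"
  assumes "universal_central_extension N E \<phi> G" "central_extension H K \<psi> G"
  shows "\<exists>!\<theta>. \<theta> \<in> mla_hom E K \<and> \<theta> \<in> extensional (carrier E) \<and>
    (\<forall>x\<in>carrier E. \<psi> (\<theta> x) = \<phi> x)"
  by (rule assms(1) [unfolded universal_central_extension_def, THEN conjunct2, rule_format, OF assms(2)])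

text \<open>The derived ideal of \<open>Gs\<close> still covers the perfect algebra \<open>G\<close>, so universality maps \<open>Gs\<close>
  into it, over \<open>G\<close>; by uniqueness this map is the identity.\<close>

lemma universal_central_extension_perfect:
  fixes G Gs :: "'u mla"
  assumes G: "mla_perfect G" and U: "universal_central_extension N Gs \<phi> G"
  shows "mla_perfect Gs"
proof -
  let ?P = "mla_commutator Gs (carrier Gs) (carrier Gs)"
  let ?E = "Gs\<lparr>carrier := ?P\<rparr>"
  have C: "central_extension N Gs \<phi> G"
    using U by (simp add: universal_central_extension_def)
  then have GsG: "mult_lie_algebra Gs" "mult_lie_algebra G" and \<phi>: "\<phi> \<in> mla_hom Gs G"
    and onto: "\<phi> ` carrier Gs = carrier G" and N: "kernel Gs G \<phi> \<subseteq> mla_center Gs"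
    by (auto simp: central_extension_def mla_short_exact_def)
  interpret Gs: mult_lie_algebra Gs by (rule GsG)
  interpret G: mult_lie_algebra G by (rule GsG)
  interpret P: normal ?P Gs
    by (intro Gs.mla_commutator_normal Gs.carrier_normal)
  have lie: "x \<star>\<^bsub>Gs\<^esub> y \<in> ?P" if "x \<in> ?P" "y \<in> ?P" for x y
    using Gs.mla_commutator_mem(1) that P.subset by blast
  have E: "mult_lie_algebra ?E"
    by (rule Gs.mult_lie_algebra_subgroup [OF P.subgroup_axioms lie])
  have one: "\<one>\<^bsub>G\<^esub> \<in> mla_center G"
    using G.lie_mult_left [OF G.one_closed G.one_closed]
    by (auto simp add: conj_by_def G.lie_closed simp: mla_center_def lie_center_def group_center_def)
  \<comment> \<open>As \<phi> is onto, the central correction can be taken to be the unit.\<close>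
  have "mla_commutator G (carrier G) (carrier G) \<subseteq> \<phi> ` ?P"
  proof (rule mla_commutator_subset_image [OF GsG \<phi>])
    fix y assume "y \<in> carrier G"
    then obtain x where "x \<in> carrier Gs" "y = \<phi> x"
      using onto by blast
    then have "x \<in> carrier Gs" "y = \<one>\<^bsub>G\<^esub> \<otimes>\<^bsub>G\<^esub> \<phi> x"
      using mla_hom_closed [OF \<phi>] by auto
    with one show "\<exists>z\<in>mla_center G. \<exists>x\<in>carrier Gs. y = z \<otimes>\<^bsub>G\<^esub> \<phi> x"
      by blast
  qed
  then have "\<phi> ` ?P = carrier G"
    using G onto P.subset unfolding mla_perfect_def by blast
  moreover have "\<phi> \<in> mla_hom ?E G"
    using \<phi> by (auto simp: mla_hom_def hom_def)
  moreover have "kernel ?E G \<phi> \<subseteq> mla_center ?E"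
  proof
    fix x assume "x \<in> kernel ?E G \<phi>"
    then have x: "x \<in> ?P" "x \<in> mla_center Gs"
      using N P.subset unfolding kernel_def by auto
    then have "x \<star>\<^bsub>Gs\<^esub> y = \<one>\<^bsub>Gs\<^esub>" "x \<otimes>\<^bsub>Gs\<^esub> y = y \<otimes>\<^bsub>Gs\<^esub> x" if "y \<in> ?P" for y
      using that P.subset Gs.lie_mla_center(1) [of x y] Gs.mult_mla_center [of x y] by blast+
    with x(1) show "x \<in> mla_center ?E"
      by (simp add: mla_center_def lie_center_def group_center_def)
  qed
  ultimately have "central_extension (kernel ?E G \<phi>) ?E \<phi> G"
    using E GsG unfolding central_extension_def mla_short_exact_def by simp
  then obtain \<sigma> where \<sigma>: "\<sigma> \<in> mla_hom Gs ?E" "\<sigma> \<in> extensional (carrier Gs)"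
    "\<forall>x\<in>carrier Gs. \<phi> (\<sigma> x) = \<phi> x"
    using universal_central_extensionD [OF U] by blast
  \<comment> \<open>\<tau> names the only endomorphism of \<open>Gs\<close> over \<open>G\<close>.
    Both \<sigma>, read as a map into \<open>Gs\<close>, and the identity are such
    endomorphisms.\<close>
  obtain \<tau> where \<tau>: "\<And>\<theta>. \<lbrakk>\<theta> \<in> mla_hom Gs Gs; \<theta> \<in> extensional (carrier Gs);
      \<forall>x\<in>carrier Gs. \<phi> (\<theta> x) = \<phi> x\<rbrakk> \<Longrightarrow> \<theta> = \<tau>"
    using universal_central_extensionD [OF U C] by blast
  have "\<sigma> \<in> mla_hom Gs Gs"
    using \<sigma>(1) P.subset unfolding mla_hom_def hom_def Pi_def by (auto simp: subset_iff)
  then have "\<sigma> = \<tau>"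
    using \<sigma>(2,3) by (rule \<tau>)
  also have "(\<lambda>x\<in>carrier Gs. x) \<in> mla_hom Gs Gs"
    by (rule mla_hom_restrict [OF GsG(1)]) (simp add: mla_hom_def hom_def)
  then have "\<tau> = (\<lambda>x\<in>carrier Gs. x)"
    by (intro \<tau> [symmetric]) auto
  finally have "\<sigma> = (\<lambda>x\<in>carrier Gs. x)" .
  then have "carrier Gs \<subseteq> ?P"
    using mla_hom_closed [OF \<sigma>(1)] by auto
  then show ?thesis
    using P.subset by (auto simp: mla_perfect_def)
qed

section \<open>Lifting from a free presentation\<close>

lemma free_mla_hom_eq:
  fixes F K :: "'u mla"
  assumes F: "free_mla F B" and K: "mult_lie_algebra K"
    and f: "f \<in> mla_hom F K" and g: "g \<in> mla_hom F K"
    and eq: "\<And>b. b \<in> B \<Longrightarrow> f b = g b" and x: "x \<in> carrier F"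
  shows "f x = g x"
proof -
  have F': "mult_lie_algebra F" and B: "B \<subseteq> carrier F"
    using F by (simp_all add: free_mla_def)
  have "f \<in> B \<rightarrow> carrier K"
    using B mla_hom_closed [OF f] by auto
  then have "\<exists>!h. h \<in> mla_hom F K \<and> h \<in> extensional (carrier F) \<and> (\<forall>x\<in>B. h x = f x)"
    using F K by (simp add: free_mla_def)
  then obtain h where h: "\<And>k. \<lbrakk>k \<in> mla_hom F K; k \<in> extensional (carrier F); \<forall>x\<in>B. k x = f x\<rbrakk> \<Longrightarrow> k = h"
    by blast
  \<comment> \<open>Freeness gives uniqueness only among extensional maps, so the restrictions are
    compared.\<close>
  have "restrict f (carrier F) = h"
    using B by (intro h mla_hom_restrict F' f) auto
  moreover have "restrict g (carrier F) = h"
    using B eq by (intro h mla_hom_restrict F' g) auto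
  ultimately have "restrict f (carrier F) x = restrict g (carrier F) x"
    by simp
  then show ?thesis
    using x by simp
qed

text \<open>Each basis element is sent to some preimage under \<phi> of its image under \<pi>. The
  composite of the extension with \<phi> agrees with \<pi> on the basis, hence everywhere.\<close>

lemma free_presentation_lift:
  fixes F E G :: "'u mla"
  assumes F: "free_presentation R F B \<pi> G" and E: "mla_short_exact N E \<phi> G"
  shows "\<exists>h\<in>mla_hom F E. \<forall>x\<in>carrier F. \<phi> (h x) = \<pi> x"
proof -
  have free: "free_mla F B" and FG: "mult_lie_algebra F" "mult_lie_algebra G"
    and \<pi>: "\<pi> \<in> mla_hom F G" and B: "B \<subseteq> carrier F"
    using F by (simp_all add: free_presentation_def free_mla_def mla_short_exact_def)
  have E': "mult_lie_algebra E" and \<phi>: "\<phi> \<in> mla_hom E G" and onto: "\<phi> ` carrier E = carrier G"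
    using E by (simp_all add: mla_short_exact_def)
  have "\<forall>b\<in>B. \<exists>e\<in>carrier E. \<phi> e = \<pi> b"
    using onto mla_hom_closed [OF \<pi>] B by (metis imageE subsetD)
  then obtain f where f: "\<forall>b\<in>B. f b \<in> carrier E \<and> \<phi> (f b) = \<pi> b"
    by metis
  then have "f \<in> B \<rightarrow> carrier E"
    by auto
  then obtain h where h: "h \<in> mla_hom F E" "\<forall>x\<in>B. h x = f x"
    using free E' unfolding free_mla_def by blast
  have "(\<phi> \<circ> h) x = \<pi> x" if "x \<in> carrier F" for x
    by (rule free_mla_hom_eq [OF free FG(2) mla_hom_compose [OF FG(1) h(1) \<phi>] \<pi> _ that])
      (use h f in auto)
  then show ?thesis
    using h(1) by auto
qed

text \<open>Both brackets are trivial: \<open>R \<star> R\<close> lies in \<open>[R,F]\<close>, and \<open>N\<close> is central.\<close>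

lemma schur_multiplier_isomorphic:
  fixes F E G :: "'u mla"
  assumes F: "mla_short_exact R F \<pi> G" and E: "central_extension N E \<phi> G"
    and h: "h \<in> mla_hom F E" and onto: "h ` (mla_commutator F (carrier F) (carrier F) \<inter> R) = N"
    and ker: "\<And>x. x \<in> mla_commutator F (carrier F) (carrier F) \<inter> R \<Longrightarrow>
      h x = \<one>\<^bsub>E\<^esub> \<longleftrightarrow> x \<in> mla_commutator F R (carrier F)"
    and sub: "mla_commutator F R (carrier F) \<subseteq> mla_commutator F (carrier F) (carrier F) \<inter> R"
  shows "mla_isomorphic (E\<lparr>carrier := N\<rparr>) (schur_multiplier R F)"
proof -
  let ?H = "mla_commutator F R (carrier F)"
  let ?Q = "F\<lparr>carrier := mla_commutator F (carrier F) (carrier F) \<inter> R\<rparr>"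
  let ?N = "E\<lparr>carrier := N\<rparr>"
  have FG: "mult_lie_algebra F" "mult_lie_algebra G" and \<pi>: "\<pi> \<in> mla_hom F G"
    and R: "R = kernel F G \<pi>"
    using F by (simp_all add: mla_short_exact_def)
  have E': "mult_lie_algebra E" and \<phi>: "\<phi> \<in> mla_hom E G" and N: "N = kernel E G \<phi>"
    and central: "N \<subseteq> mla_center E"
    using E by (auto simp: central_extension_def mla_short_exact_def)
  interpret E: mult_lie_algebra E by fact
  interpret R: mla_ideal R F
    unfolding R by (rule kernel_ideal [OF FG \<pi>])
  interpret N: mla_ideal N E
    unfolding N by (rule kernel_ideal [OF E' FG(2) \<phi>])
  interpret H: mla_ideal ?H F
    by (rule R.commutator_ideal)
  have "subgroup (mla_commutator F (carrier F) (carrier F) \<inter> R) F"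
    by (intro R.subgroups_Inter_pair R.subgroup_axioms normal_imp_subgroup
        R.mla_commutator_normal R.carrier_normal)
  then interpret Q: group ?Q
    by (rule R.subgroup_imp_group)
  interpret Ngrp: group ?N
    by (rule E.subgroup_imp_group [OF N.subgroup_axioms])
  have "h \<in> hom ?Q ?N"
    using h onto R.subset by (auto simp: mla_hom_def hom_def)
  then interpret hQ: group_hom ?Q ?N h
    by unfold_locales
  have kernel: "kernel ?Q ?N h = ?H"
    using ker sub by (auto simp: kernel_def)
  have img: "h ` carrier ?Q = carrier ?N"
    using onto by simp
  \<comment> \<open>The first isomorphism theorem for \<open>h\<close> on \<open>?Q\<close>,
    inverted to start from \<open>N\<close>.\<close>
  obtain g where g: "g \<in> iso ?N (?Q Mod ?H)"
    using hQ.FactGroup_iso_set [OF img] group.iso_set_sym [OF normal.factorgroup_is_group [OF hQ.normal_kernel]]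
    unfolding kernel by blast
  have lie: "g (x \<star>\<^bsub>E\<^esub> y) = g x \<star>\<^bsub>schur_multiplier R F\<^esub> g y" if xy: "x \<in> N" "y \<in> N" for x y
  proof -
    have "x \<star>\<^bsub>E\<^esub> y = \<one>\<^bsub>E\<^esub>"
      using xy central N.subset E.lie_mla_center by blast
    moreover have "g \<one>\<^bsub>E\<^esub> = ?H"
    proof -
      have "group (?Q Mod ?H)"
        using normal.factorgroup_is_group [OF hQ.normal_kernel] by (simp add: kernel)
      then have "group_hom ?N (?Q Mod ?H) g"
        using g Ngrp.group_axioms by (simp add: group_hom_def group_hom_axioms_def iso_def)
      from group_hom.hom_one [OF this] show ?thesis
        by simp
    qed
    moreover have "g x \<star>\<^bsub>schur_multiplier R F\<^esub> g y = ?H"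
    proof -
      \<comment> \<open>Nonemptiness keeps the union defining the quotient bracket from being empty;
        containment in \<open>R\<close> makes every bracket in it a generator of
        \<open>?H\<close>.\<close>
      have coset: "g z \<noteq> {} \<and> g z \<subseteq> R" if "z \<in> N" for z
      proof -
        have "g z \<in> carrier (?Q Mod ?H)"
          using g that by (auto simp: iso_def hom_def)
        then obtain q where q: "q \<in> R" "g z = ?H #>\<^bsub>F\<^esub> q"
          by (auto simp: FactGroup_def RCOSETS_def)
        moreover have "?H \<noteq> {}"
          using H.one_closed by blast
        ultimately show ?thesis
          using sub by (auto simp: r_coset_def)
      qed
      have "?H #>\<^bsub>F\<^esub> (a \<star>\<^bsub>F\<^esub> b) = ?H" if "a \<in> g x" "b \<in> g y" for a b
      proof (rule R.coset_join2 [OF _ H.subgroup_axioms])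
        have ab: "a \<in> R" "b \<in> R"
          using that coset xy by blast+
        then show "a \<star>\<^bsub>F\<^esub> b \<in> carrier F"
          by simp
        show "a \<star>\<^bsub>F\<^esub> b \<in> ?H"
          using R.mla_commutator_mem(1) [of R "carrier F" a b] R.subset ab by blast
      qed
      then show ?thesis
        using coset [OF xy(1)] coset [OF xy(2)]
        by (auto simp: schur_multiplier_def mla_quotient_def)
    qed
    ultimately show ?thesis
      by simp
  qed
  have "g \<in> mla_hom ?N (schur_multiplier R F)"
    using g lie by (auto simp: mla_hom_def iso_def hom_def FactGroup_def schur_multiplier_def mla_quotient_def)
  moreover have "bij_betw g (carrier ?N) (carrier (schur_multiplier R F))"
    using g by (simp add: iso_def FactGroup_def schur_multiplier_def mla_quotient_def)
  ultimately show ?thesis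
    unfolding mla_isomorphic_def by blast
qed

theorem corollary4p12:
  fixes G Gs F :: "'u mla"
    and N R B :: "'u set"
    and \<phi> \<pi> :: "'u \<Rightarrow> 'u"
  assumes "mla_perfect G"
    and "universal_central_extension N Gs \<phi> G"
    and "free_presentation R F B \<pi> G"
  shows "mla_isomorphic (Gs\<lparr>carrier := N\<rparr>) (schur_multiplier R F) \<and>
    stem_cover N Gs \<phi> G R F \<and> is_cover Gs G R F"
proof -
  let ?P = "mla_commutator F (carrier F) (carrier F)" and ?H = "mla_commutator F R (carrier F)"
  let ?K = "rep_quotient F ?H" and ?r = "coset_rep F ?H"
  have C: "central_extension N Gs \<phi> G"
    using assms(2) by (simp add: universal_central_extension_def)
  then have S: "mla_short_exact N Gs \<phi> G" and Gs: "mult_lie_algebra Gs"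
    and \<phi>: "\<phi> \<in> mla_hom Gs G" and N: "N = kernel Gs G \<phi>" "N \<subseteq> mla_center Gs"
    by (auto simp: central_extension_def mla_short_exact_def)
  have SF: "mla_short_exact R F \<pi> G" and FG: "mult_lie_algebra F" "mult_lie_algebra G"
    and \<pi>: "\<pi> \<in> mla_hom F G" and onto: "\<pi> ` carrier F = carrier G" and R: "R = kernel F G \<pi>"
    using assms(3) by (simp_all add: free_presentation_def mla_short_exact_def)
  interpret Gs: mult_lie_algebra Gs by fact
  interpret R: mla_ideal R F
    unfolding R by (rule kernel_ideal [OF FG \<pi>])
  interpret H: mla_ideal ?H F
    by (rule R.commutator_ideal)
  have P: "?P \<subseteq> carrier F"
    by (intro subgroup.subset normal_imp_subgroup R.mla_commutator_normal R.carrier_normal)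
  have perfect: "mla_commutator Gs (carrier Gs) (carrier Gs) = carrier Gs"
    using universal_central_extension_perfect [OF assms(1,2)] by (simp add: mla_perfect_def)

  obtain h where h: "h \<in> mla_hom F Gs" and \<phi>h: "\<And>x. x \<in> carrier F \<Longrightarrow> \<phi> (h x) = \<pi> x"
    using free_presentation_lift [OF assms(3) S] by blast
  note K = central_extension_rep_quotient [OF SF refl]
  obtain \<theta> where \<theta>: "\<theta> \<in> mla_hom Gs ?K" "\<forall>x\<in>carrier Gs. \<pi> (\<theta> x) = \<phi> x"
    using universal_central_extensionD [OF assms(2) K(1)] by blast

  \<comment> \<open>Since \<open>h\<close> lies over \<open>G\<close>, the preimage of the kernel of
    \<phi> is the kernel of \<pi>.\<close>
  have hR: "h x \<in> N \<longleftrightarrow> x \<in> R" if "x \<in> carrier F" for x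
    using that mla_hom_closed [OF h that] unfolding N R kernel_def by (simp add: \<phi>h)
  have hP: "mla_commutator Gs (carrier Gs) (carrier Gs) \<subseteq> h ` ?P"
  proof (rule mla_commutator_subset_image [OF FG(1) Gs h])
    fix y assume y: "y \<in> carrier Gs"
    \<comment> \<open>Surjectivity of \<pi> provides an \<open>h x\<close> with the same image in
      \<open>G\<close> as \<open>y\<close>; the two then differ by a central element.\<close>
    then obtain x where x: "x \<in> carrier F" "\<phi> y = \<phi> (h x)"
      using onto mla_hom_closed [OF \<phi>] \<phi>h by (metis imageE)
    then show "\<exists>z\<in>mla_center Gs. \<exists>x\<in>carrier F. y = z \<otimes>\<^bsub>Gs\<^esub> h x"
      using central_extension_differ_by_center [OF C y mla_hom_closed [OF h]] by blast
  qed
  have img: "h ` (?P \<inter> R) = N"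
  proof (intro equalityI subsetI)
    fix y assume "y \<in> h ` (?P \<inter> R)"
    then show "y \<in> N"
      using hR P by auto
  next
    fix y assume "y \<in> N"
    moreover from this obtain x where "x \<in> ?P" "y = h x"
      using hP N(2) Gs.mla_center_subset unfolding perfect by blast
    ultimately show "y \<in> h ` (?P \<inter> R)"
      using hR [of x] P by auto
  qed

  have \<theta>h: "(\<theta> \<circ> h) x = ?r x" if x: "x \<in> ?P" for x
  proof (rule mla_hom_eq_on_commutator [OF FG(1) H.rep_quotient_mult_lie_algebra
        mla_hom_compose [OF FG(1) h \<theta>(1)] H.coset_rep_hom _ x])
    fix x assume x: "x \<in> carrier F"
    then have "\<pi> ((\<theta> \<circ> h) x) = \<pi> (?r x)"
      using \<theta>(2) mla_hom_closed [OF h] by (simp add: K(2) \<phi>h)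
    then show "\<exists>z\<in>mla_center ?K. (\<theta> \<circ> h) x = z \<otimes>\<^bsub>?K\<^esub> ?r x"
      by (intro central_extension_differ_by_center [OF K(1)] x
          mla_hom_closed [OF mla_hom_compose [OF FG(1) h \<theta>(1)]] mla_hom_closed [OF H.coset_rep_hom])
  qed
  have ker: "h x = \<one>\<^bsub>Gs\<^esub> \<longleftrightarrow> x \<in> ?H" if x: "x \<in> ?P \<inter> R" for x
  proof
    interpret K: mult_lie_algebra ?K
      by (rule H.rep_quotient_mult_lie_algebra)
    interpret \<theta>: group_hom Gs ?K \<theta>
      by (rule mla_hom_group_hom [OF Gs K.mult_lie_algebra_axioms \<theta>(1)])
    assume "h x = \<one>\<^bsub>Gs\<^esub>"
    \<comment> \<open>On \<open>?P\<close> the quotient map factors through \<open>h\<close>, so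
      whatever \<open>h\<close> kills there lies in \<open>?H\<close>.\<close>
    then have "?r x = \<one>\<^bsub>?K\<^esub>"
      using \<theta>h [of x] x by simp
    then show "x \<in> ?H"
      using H.coset_rep_eq_one_iff x P by blast
  next
    assume "x \<in> ?H"
    moreover have "?H \<subseteq> kernel F Gs h"
      using hR N(2) R.subset by (intro mla_commutator_kernel [OF FG(1) Gs h]) auto
    ultimately show "h x = \<one>\<^bsub>Gs\<^esub>"
      by (auto simp: kernel_def)
  qed
  have "?H \<subseteq> ?P"
    using R.mla_commutator_mem [of "carrier F" "carrier F"] R.subset
    by (intro R.mla_commutator_least normal_imp_subgroup R.mla_commutator_normal R.carrier_normal) auto
  then have "?H \<subseteq> ?P \<inter> R"
    using R.commutator_ideal(1) by blast
  with img ker have iso: "mla_isomorphic (Gs\<lparr>carrier := N\<rparr>) (schur_multiplier R F)"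
    by (intro schur_multiplier_isomorphic [OF SF C h])
  \<comment> \<open>The stem condition is immediate, because the derived ideal of \<open>Gs\<close>
    is all of \<open>Gs\<close>.\<close>
  moreover have "stem_extension N Gs \<phi> G"
    using C N(2) Gs.mla_center_subset by (auto simp: stem_extension_def perfect)
  ultimately show ?thesis
    unfolding is_cover_def stem_cover_def by blast
qed

end
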